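(* Let $m\ge1$ be an integer and let $0=x_0<x_1<\cdots<x_m<x_{m+1}=1$. Let $B$ be the set of those $b=(b_1,\dots,b_m)\in\mathbb{R}^m$ for which the problem $$-u''=0\text{ on }(0,1)\setminus\{x_1,\dots,x_m\},\quad u(0)=u(1)=0,\quad u(x_j^+)=u(x_j^-),\quad u'(x_j^+)=u'(x_j^-)-b_j\,u(x_j),\ j=1,\dots,m,$$ has a nontrivial solution. For $k=1,\dots,m$ let $$w_k(x)=\begin{cases}(1-x_k)\,x,&0\le x\le x_k,\\ x_k\,(1-x),&x_k\le x\le1.\end{cases}$$ Then $$B=\big\{b\in\mathbb{R}^m:\det\big(w_k(x_j)\,b_j-\delta_{jk}\big)_{j,k=1}^m=0\big\}.$$
   Context: $u(x_j^\pm)$ and $u'(x_j^\pm)$ denote one-sided limits at $x_j$ from the right ($+$) and left ($-$). $\delta_{jk}$ is the Kronecker delta. The set $B$ is called the resonance set. *)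

theory Defs
  imports "HOL-Analysis.Analysis" "Jordan_Normal_Form.Determinant"
begin

unbundle no vec_syntax
hide_const (open) Determinants.det Finite_Cartesian_Product.vec Finite_Cartesian_Product.mat

text \<open>
  The nodes are a function \<open>x\<close> on \<open>{0..Suc m}\<close>. Vectors and matrices are indexed from \<open>0\<close>,
  so \<open>b $ (j - 1)\<close> is the strength attached to the node \<open>x j\<close>.

  A solution is a function on \<open>[0,1]\<close>. The boundary values are attained continuously; otherwise a
  jump at an endpoint would make every problem nontrivially solvable. Likewise the common one-sided
  limit of \<open>u\<close> at a node is the value \<open>u (x j)\<close> occurring in the jump condition.
\<close>

definition is_solution :: "nat \<Rightarrow> (nat \<Rightarrow> real) \<Rightarrow> real vec \<Rightarrow> (real \<Rightarrow> real) \<Rightarrow> bool" where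
  "is_solution m x b u \<longleftrightarrow>
     (\<forall>t\<in>{0<..<1} - x ` {1..m}.
        u differentiable (at t) \<and> deriv u differentiable (at t) \<and> - deriv (deriv u) t = 0) \<and>
     u 0 = 0 \<and> (u \<longlongrightarrow> u 0) (at_right 0) \<and>
     u 1 = 0 \<and> (u \<longlongrightarrow> u 1) (at_left 1) \<and>
     (\<forall>j\<in>{1..m}.
        (u \<longlongrightarrow> u (x j)) (at_left (x j)) \<and> (u \<longlongrightarrow> u (x j)) (at_right (x j)) \<and>
        (\<exists>p q. (deriv u \<longlongrightarrow> p) (at_left (x j)) \<and> (deriv u \<longlongrightarrow> q) (at_right (x j)) \<and>
               q = p - b $ (j - 1) * u (x j)))"

definition resonance_set :: "nat \<Rightarrow> (nat \<Rightarrow> real) \<Rightarrow> real vec set" where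
  "resonance_set m x =
     {b \<in> carrier_vec m. \<exists>u. is_solution m x b u \<and> (\<exists>t\<in>{0..1}. u t \<noteq> 0)}"

definition w :: "(nat \<Rightarrow> real) \<Rightarrow> nat \<Rightarrow> real \<Rightarrow> real" where
  "w x k t = (if t \<le> x k then (1 - x k) * t else x k * (1 - t))"

end

theory Submission
  imports Defs
begin

text \<open>
  The function \<open>w\<^sub>k\<close> is the Green's function of \<open>-d\<^sup>2/dt\<^sup>2\<close> with Dirichlet conditions and pole \<open>x\<^sub>k\<close>:
  it is continuous, affine off \<open>x\<^sub>k\<close>, and its slope drops by \<open>1\<close> there. If \<open>u\<close> is a solution and
  \<open>v\<^sub>k = b\<^sub>k u(x\<^sub>k)\<close>, then \<open>u - (\<Sum>k. v\<^sub>k w\<^sub>k)\<close> has no slope jumps, hence is affine and, by the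
  boundary conditions, zero. So \<open>u = (\<Sum>k. v\<^sub>k w\<^sub>k)\<close>, and evaluating at \<open>x\<^sub>j\<close> and multiplying
  by \<open>b\<^sub>j\<close> says that \<open>v\<close> lies in the kernel of the matrix. Conversely each kernel vector \<open>v\<close>
  gives the solution \<open>\<Sum>k. v\<^sub>k w\<^sub>k\<close>.
\<close>

section \<open>Uniqueness for affine functions with removable slope gaps\<close>

lemma eventually_at_not_in_finite:
  fixes t :: "'a::t1_space"
  assumes "finite X"
  shows "eventually (\<lambda>s. s \<notin> X) (at t)"
proof -
  have "open (- (X - {t}))"
    using assms by (intro open_Compl finite_imp_closed finite_Diff)
  then show ?thesis
    unfolding eventually_at_topological by (intro exI[of _ "- (X - {t})"]) auto
qed

lemma eventually_nhds_not_in_finite: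
  fixes t :: "'a::t1_space"
  assumes "finite X" "t \<notin> X"
  shows "eventually (\<lambda>s. s \<notin> X) (nhds t)"
  using assms eventually_at_not_in_finite[of X t] by (simp add: eventually_nhds_conv_at)

text \<open>With its gaps filled by limits, the slope \<open>d\<close> is continuous with zero
  derivative off a finite set, hence a constant \<open>c\<close>. Then \<open>z t = c * t\<close> on
  the interval, and \<open>z 1 = 0\<close> forces \<open>c = 0\<close>.\<close>

lemma piecewise_affine_without_kinks_eq_zero:
  fixes z d :: "real \<Rightarrow> real"
  assumes fin: "finite X"
    and cont: "continuous_on {0..1} z" and z0: "z 0 = 0" and z1: "z 1 = 0"
    and zd: "\<And>t. t \<in> {0<..<1} - X \<Longrightarrow> (z has_real_derivative d t) (at t)"
    and dd: "\<And>t. t \<in> {0<..<1} - X \<Longrightarrow> (d has_real_derivative 0) (at t)"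
    and lim: "\<And>t. t \<in> {0<..<1} \<inter> X \<Longrightarrow> \<exists>p. (d \<longlongrightarrow> p) (at t)"
    and t: "t \<in> {0..1}"
  shows "z t = 0"
proof -
  \<comment> \<open>Taking the limit of \<open>d\<close> at each point of \<open>X\<close> makes
    \<open>g\<close> continuous on the whole open interval, while \<open>g\<close> still agrees with
    \<open>d\<close> near every other interior point.\<close>
  define g where "g t = (if t \<in> X then Lim (at t) d else d t)" for t
  have g_deriv: "(g has_real_derivative 0) (at t)" if "t \<in> {0<..<1} - X" for t
  proof -
    have "eventually (\<lambda>s. g s = d s) (nhds t)"
      using eventually_nhds_not_in_finite[OF fin, of t] that
      by (auto elim!: eventually_mono simp: g_def)
    then show ?thesis
      using dd[OF that] by (subst DERIV_cong_ev[OF refl _ refl])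
  qed
  have "isCont g t" if "t \<in> {0<..<1}" for t
  proof (cases "t \<in> X")
    case True
    with that lim obtain p where p: "(d \<longlongrightarrow> p) (at t)" by blast
    have "g t = p"
      using True p by (simp add: g_def tendsto_Lim)
    moreover have "eventually (\<lambda>s. d s = g s) (at t)"
      using eventually_at_not_in_finite[OF fin, of t]
      by (auto elim!: eventually_mono simp: g_def)
    ultimately show ?thesis
      using Lim_transform_eventually[OF p] by (simp add: isCont_def)
  next
    case False
    then show ?thesis using g_deriv that DERIV_isCont by blast
  qed
  then have "continuous_on {0<..<1} g"
    by (simp add: continuous_at_imp_continuous_on)
  then have "g constant_on {0<..<1}"
    using g_deriv fin by (intro DERIV_zero_connected_constant_on[of _ X]) auto
  then have g_const: "g t = g (1/2)" if "t \<in> {0<..<1}" for t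
    using that unfolding constant_on_def by auto
  define c where "c = g (1/2)"
  have zc: "z t = c * t" if "t \<in> {0..1}" for t
  proof -
    have "(z has_real_derivative c) (at t)" if "t \<in> {0<..<1} - X" for t
      using zd[OF that] g_const[of t] that by (simp add: g_def c_def)
    \<comment> \<open>The endpoints join the exceptional set, because derivatives are known only in
      the interior; continuity on \<open>{0..1}\<close> and \<open>z 0 = 0\<close> cover the
      rest.\<close>
    then have "((\<lambda>t. z t - c * t) has_real_derivative 0) (at t)"
      if "t \<in> {0..1} - (X \<union> {0, 1})" for t
      using that by (auto intro!: derivative_eq_intros)
    from has_derivative_at_withinI[OF has_field_derivative_imp_has_derivative[OF this]]
    have diff0: "((\<lambda>t. z t - c * t) has_derivative (\<lambda>h. 0)) (at t within {0..1})"
      if "t \<in> {0..1} - (X \<union> {0, 1})" for t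
      using that by (simp add: lambda_zero)
    have cont0: "continuous_on {0..1} (\<lambda>t. z t - c * t)"
      by (intro continuous_intros cont)
    have "z t - c * t = 0"
      by (rule has_derivative_zero_unique_strong_interval
            [of "X \<union> {0, 1}", OF _ cont0 _ diff0 that])
        (use fin z0 in auto)
    then show ?thesis by simp
  qed
  show ?thesis using zc[OF t] zc[of 1] z1 by simp
qed

section \<open>Green's functions and their slopes\<close>

definition w_slope :: "(nat \<Rightarrow> real) \<Rightarrow> nat \<Rightarrow> real \<Rightarrow> real" where
  "w_slope x k t = (if t < x k then 1 - x k else - x k)"

text \<open>The two branches differ by \<open>t - x k\<close>, so the case split selects the smaller
  one. In this form continuity is immediate.\<close>

lemma w_eq_min: "w x k t = min ((1 - x k) * t) (x k * (1 - t))"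
  by (auto simp: w_def min_def algebra_simps)

lemma isCont_w: "isCont (w x k) t"
  unfolding w_eq_min[abs_def] by (intro continuous_intros)

lemma w_slope_eventually_const:
  assumes "t \<noteq> x k"
  shows "eventually (\<lambda>s. w_slope x k s = w_slope x k t) (nhds t)"
proof (cases "t < x k")
  case True
  then show ?thesis
    using eventually_nhds_in_open[of "{..<x k}" t] by (auto elim!: eventually_mono simp: w_slope_def)
next
  case False
  then show ?thesis
    using assms eventually_nhds_in_open[of "{x k<..}" t]
    by (auto elim!: eventually_mono simp: w_slope_def)
qed

lemma DERIV_w_slope:
  assumes "t \<noteq> x k"
  shows "(w_slope x k has_real_derivative 0) (at t)"
  using assms by (subst DERIV_cong_ev[OF refl w_slope_eventually_const refl]) auto

lemma DERIV_w:
  assumes "t \<noteq> x k"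
  shows "(w x k has_real_derivative w_slope x k t) (at t)"
proof (cases "t < x k")
  case True
  then have "eventually (\<lambda>s. w x k s = (1 - x k) * s) (nhds t)"
    using eventually_nhds_in_open[of "{..<x k}" t] by (auto elim!: eventually_mono simp: w_def)
  moreover have "((\<lambda>s. (1 - x k) * s) has_real_derivative w_slope x k t) (at t)"
    using True by (auto intro!: derivative_eq_intros simp: w_slope_def)
  ultimately show ?thesis by (subst DERIV_cong_ev[OF refl _ refl])
next
  case False
  then have "eventually (\<lambda>s. w x k s = x k * (1 - s)) (nhds t)"
    using assms eventually_nhds_in_open[of "{x k<..}" t]
    by (auto elim!: eventually_mono simp: w_def)
  moreover have "((\<lambda>s. x k * (1 - s)) has_real_derivative w_slope x k t) (at t)"
    using False by (auto intro!: derivative_eq_intros simp: w_slope_def)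
  ultimately show ?thesis by (subst DERIV_cong_ev[OF refl _ refl])
qed

text \<open>At the pole \<open>w_slope\<close> is given its right-hand value, so no correction
  appears here and the whole jump is recorded in the left limit.\<close>

lemma w_slope_at_right: "(w_slope x k \<longlongrightarrow> w_slope x k t) (at_right t)"
proof (cases "t = x k")
  case True
  have "eventually (\<lambda>s. w_slope x k s = w_slope x k t) (at_right t)"
    using True by (auto simp: eventually_at_filter w_slope_def)
  then show ?thesis by (rule tendsto_eventually)
next
  case False
  then show ?thesis
    using DERIV_isCont[OF DERIV_w_slope] by (auto simp: isCont_def filterlim_at_split)
qed

text \<open>The correction is the drop from \<open>1 - x k\<close> to \<open>- x k\<close>: the unit
  source of the Green's function.\<close>

lemma w_slope_at_left: "(w_slope x k \<longlongrightarrow> w_slope x k t + of_bool (t = x k)) (at_left t)"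
proof (cases "t = x k")
  case True
  have "eventually (\<lambda>s. w_slope x k s = w_slope x k t + of_bool (t = x k)) (at_left t)"
    using True by (auto simp: eventually_at_filter w_slope_def)
  then show ?thesis by (rule tendsto_eventually)
next
  case False
  then show ?thesis
    using DERIV_isCont[OF DERIV_w_slope] by (auto simp: isCont_def filterlim_at_split)
qed

section \<open>Combinations of Green's functions as solutions\<close>

locale nodes =
  fixes m :: nat and x :: "nat \<Rightarrow> real"
  assumes x0: "x 0 = 0" and x1: "x (m + 1) = 1"
    and x_step: "\<And>i. i \<le> m \<Longrightarrow> x i < x (i + 1)"
begin

lemma x_less: "i < j \<Longrightarrow> j \<le> m + 1 \<Longrightarrow> x i < x j"
proof (induction j)
  case (Suc j)
  then show ?case using x_step[of j] by (cases "i = j") auto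
qed simp

lemma x_in: "j \<in> {1..m} \<Longrightarrow> x j \<in> {0<..<1}"
  using x_less[of 0 j] x_less[of j "m + 1"] x0 x1 by auto

lemma x_eq_iff: "j \<in> {1..m} \<Longrightarrow> k \<in> {1..m} \<Longrightarrow> x j = x k \<longleftrightarrow> j = k"
  using x_less[of j k] x_less[of k j] by (cases j k rule: linorder_cases) auto

definition comb :: "(nat \<Rightarrow> real) \<Rightarrow> real \<Rightarrow> real" where
  "comb v t = (\<Sum>k\<in>{1..m}. v k * w x k t)"

definition comb_slope :: "(nat \<Rightarrow> real) \<Rightarrow> real \<Rightarrow> real" where
  "comb_slope v t = (\<Sum>k\<in>{1..m}. v k * w_slope x k t)"

lemma comb_0: "comb v 0 = 0"
proof -
  have "w x k 0 = 0" if "k \<in> {1..m}" for k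
    using x_in[OF that] by (simp add: w_def)
  then show ?thesis by (simp add: comb_def)
qed

lemma comb_1: "comb v 1 = 0"
proof -
  have "w x k 1 = 0" if "k \<in> {1..m}" for k
    using x_in[OF that] by (simp add: w_def)
  then show ?thesis by (simp add: comb_def)
qed

lemma isCont_comb: "isCont (comb v) t"
  unfolding comb_def[abs_def] by (intro continuous_intros isCont_w)

lemma DERIV_comb:
  assumes "t \<notin> x ` {1..m}"
  shows "(comb v has_real_derivative comb_slope v t) (at t)"
  unfolding comb_def[abs_def] comb_slope_def
  using assms by (intro DERIV_sum DERIV_cmult DERIV_w) auto

lemma DERIV_comb_slope:
  assumes "t \<notin> x ` {1..m}"
  shows "(comb_slope v has_real_derivative 0) (at t)"
proof -
  have "((\<lambda>s. \<Sum>k\<in>{1..m}. v k * w_slope x k s) has_real_derivative (\<Sum>k\<in>{1..m}. v k * 0)) (at t)"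
    using assms by (intro DERIV_sum DERIV_cmult DERIV_w_slope) auto
  then show ?thesis by (simp add: comb_slope_def[abs_def])
qed

lemma comb_slope_at_right: "(comb_slope v \<longlongrightarrow> comb_slope v t) (at_right t)"
  unfolding comb_slope_def[abs_def] by (intro tendsto_intros w_slope_at_right)

text \<open>Distinct indices give distinct poles (\<open>x_eq_iff\<close>), so only the summand
  \<open>k = j\<close> jumps at \<open>x j\<close>, and it does so with weight
  \<open>v j\<close>.\<close>

lemma comb_slope_at_left:
  assumes "j \<in> {1..m}"
  shows "(comb_slope v \<longlongrightarrow> comb_slope v (x j) + v j) (at_left (x j))"
proof -
  have "((\<lambda>s. \<Sum>k\<in>{1..m}. v k * w_slope x k s) \<longlongrightarrow>
      (\<Sum>k\<in>{1..m}. v k * (w_slope x k (x j) + of_bool (x j = x k)))) (at_left (x j))"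
    by (intro tendsto_intros w_slope_at_left)
  moreover have "(\<Sum>k\<in>{1..m}. v k * of_bool (x j = x k)) = (\<Sum>k\<in>{1..m}. if k = j then v k else 0)"
    using assms by (intro sum.cong) (auto simp: x_eq_iff)
  ultimately show ?thesis
    using assms by (simp add: comb_slope_def[abs_def] distrib_left sum.distrib)
qed

text \<open>The filter \<open>at t\<close> leaves out \<open>t\<close> itself, so \<open>t\<close>
  may be a node, where \<open>comb v\<close> can have a kink.\<close>

lemma eventually_deriv_comb: "eventually (\<lambda>s. deriv (comb v) s = comb_slope v s) (at t)"
  using eventually_at_not_in_finite[of "x ` {1..m}" t]
  by (auto elim!: eventually_mono intro!: DERIV_imp_deriv DERIV_comb)

text \<open>The slope of \<open>comb v\<close> drops by \<open>v j\<close> at \<open>x j\<close>;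
  the hypothesis says that this is exactly the drop demanded by the jump condition.\<close>

lemma comb_is_solution:
  assumes v: "\<And>j. j \<in> {1..m} \<Longrightarrow> v j = b $ (j - 1) * comb v (x j)"
  shows "is_solution m x b (comb v)"
  unfolding is_solution_def
proof (intro conjI ballI comb_0 comb_1)
  have lim: "(comb v \<longlongrightarrow> comb v t) (at t)" for t
    using isCont_comb by (simp add: isCont_def)
  then show "(comb v \<longlongrightarrow> comb v 0) (at_right 0)" "(comb v \<longlongrightarrow> comb v 1) (at_left 1)"
    "(comb v \<longlongrightarrow> comb v (x j)) (at_left (x j))" "(comb v \<longlongrightarrow> comb v (x j)) (at_right (x j))" for j
    by (simp_all add: filterlim_at_split)
  fix t assume "t \<in> {0<..<1} - x ` {1..m}"
  then have t: "t \<notin> x ` {1..m}" by simp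
  show "comb v differentiable (at t)"
    using DERIV_comb[OF t] real_differentiable_def by blast
  have "deriv (comb v) t = comb_slope v t"
    by (rule DERIV_imp_deriv[OF DERIV_comb[OF t]])
  \<comment> \<open>A derivative at \<open>t\<close> depends on the value there too, so agreement on
    the punctured neighbourhood is completed by the equation at \<open>t\<close>.\<close>
  then have "eventually (\<lambda>s. deriv (comb v) s = comb_slope v s) (nhds t)"
    using eventually_deriv_comb by (simp add: eventually_nhds_conv_at)
  then have *: "(deriv (comb v) has_real_derivative 0) (at t)"
    using DERIV_comb_slope[OF t] by (subst DERIV_cong_ev[OF refl _ refl])
  then show "deriv (comb v) differentiable (at t)"
    using real_differentiable_def by blast
  show "- deriv (deriv (comb v)) t = 0"
    using DERIV_imp_deriv[OF *] by simp
next
  fix j assume j: "j \<in> {1..m}"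
  have ev: "eventually (\<lambda>s. comb_slope v s = deriv (comb v) s) (at_left (x j))"
    "eventually (\<lambda>s. comb_slope v s = deriv (comb v) s) (at_right (x j))"
    using eventually_deriv_comb[of v "x j"] by (simp_all add: eventually_at_split eq_commute)
  show "\<exists>p q. (deriv (comb v) \<longlongrightarrow> p) (at_left (x j)) \<and> (deriv (comb v) \<longlongrightarrow> q) (at_right (x j)) \<and>
      q = p - b $ (j - 1) * comb v (x j)"
    using Lim_transform_eventually[OF comb_slope_at_left[OF j] ev(1)]
      Lim_transform_eventually[OF comb_slope_at_right ev(2)] v[OF j]
    by (intro exI[of _ "comb_slope v (x j) + v j"] exI[of _ "comb_slope v (x j)"]) simp
qed

text \<open>Both sides vanish at 0 and 1, are affine between nodes and have the same slope jumps, so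
  their difference falls under \<open>piecewise_affine_without_kinks_eq_zero\<close>.\<close>

lemma solution_eq_comb:
  assumes u: "is_solution m x b u" and t: "t \<in> {0..1}"
  shows "u t = comb (\<lambda>j. b $ (j - 1) * u (x j)) t"
proof -
  let ?X = "x ` {1..m}"
  define v where "v = (\<lambda>j. b $ (j - 1) * u (x j))"
  note u = u[unfolded is_solution_def]
  have du: "(u has_real_derivative deriv u t) (at t)" "(deriv u has_real_derivative 0) (at t)"
    if "t \<in> {0<..<1} - ?X" for t
  proof -
    have "u differentiable (at t)" "deriv u differentiable (at t)" "deriv (deriv u) t = 0"
      using u that by auto
    then show "(u has_real_derivative deriv u t) (at t)" "(deriv u has_real_derivative 0) (at t)"
      by (metis DERIV_imp_deriv real_differentiable_def)+
  qed
  have "isCont u t" if "t \<in> {0<..<1}" for t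
  proof (cases "t \<in> ?X")
    case True
    then show ?thesis using u by (auto simp: isCont_def filterlim_at_split)
  next
    case False
    then show ?thesis using du(1)[of t] that DERIV_isCont by blast
  qed
  \<comment> \<open>At 0 and 1 continuity comes from the one-sided limits in
    \<open>is_solution\<close>.\<close>
  then have "continuous_on {0..1} u"
    using u by (intro continuous_on_IccI) (auto simp: isCont_def)
  then have cont: "continuous_on {0..1} (\<lambda>t. u t - comb v t)"
    by (intro continuous_on_diff) (simp_all add: continuous_at_imp_continuous_on isCont_comb)
  have "u t - comb v t = 0"
  proof (rule piecewise_affine_without_kinks_eq_zero[OF _ cont _ _ _ _ _ t, of ?X
        "\<lambda>t. deriv u t - comb_slope v t"])
    show "finite ?X" by simp
    show "u 0 - comb v 0 = 0" "u 1 - comb v 1 = 0"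
      using u by (simp_all add: comb_0 comb_1)
  next
    fix t assume t: "t \<in> {0<..<1} - ?X"
    show "((\<lambda>t. u t - comb v t) has_real_derivative deriv u t - comb_slope v t) (at t)"
      using t by (intro DERIV_diff du DERIV_comb) auto
    show "((\<lambda>t. deriv u t - comb_slope v t) has_real_derivative 0) (at t)"
      using DERIV_diff[OF du(2)[OF t] DERIV_comb_slope] t by simp
  next
    fix t assume "t \<in> {0<..<1} \<inter> ?X"
    then obtain j where j: "j \<in> {1..m}" "t = x j" by blast
    have "\<exists>p q. (deriv u \<longlongrightarrow> p) (at_left (x j)) \<and> (deriv u \<longlongrightarrow> q) (at_right (x j)) \<and>
        q = p - b $ (j - 1) * u (x j)"
      using u j(1) by blast
    then obtain p where "(deriv u \<longlongrightarrow> p) (at_left t)" "(deriv u \<longlongrightarrow> p - v j) (at_right t)"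
      using j(2) by (auto simp: v_def)
    \<comment> \<open>Both one-sided limits equal \<open>p - v j - comb_slope v t\<close>: the two
      jumps cancel.\<close>
    then have "((\<lambda>t. deriv u t - comb_slope v t) \<longlongrightarrow> p - (comb_slope v t + v j)) (at_left t)"
      "((\<lambda>t. deriv u t - comb_slope v t) \<longlongrightarrow> (p - v j) - comb_slope v t) (at_right t)"
      using j comb_slope_at_left comb_slope_at_right by (auto intro!: tendsto_diff)
    then show "\<exists>p. ((\<lambda>t. deriv u t - comb_slope v t) \<longlongrightarrow> p) (at t)"
      by (auto simp: filterlim_at_split algebra_simps)
  qed
  then show ?thesis by (simp add: v_def)
qed

section \<open>From solutions to the kernel of the matrix\<close>

lemma kernel_iff:
  assumes "v \<in> carrier_vec m"
  shows "mat m m (\<lambda>(j, k). w x (k + 1) (x (j + 1)) * b $ j - (if j = k then 1 else 0)) *\<^sub>v v = 0\<^sub>v m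
    \<longleftrightarrow> (\<forall>j\<in>{1..m}. v $ (j - 1) = b $ (j - 1) * comb (\<lambda>k. v $ (k - 1)) (x j))"
    (is "?M *\<^sub>v v = _ \<longleftrightarrow> _")
proof -
  \<comment> \<open>The Kronecker delta contributes \<open>- v $ j\<close>, and the other terms are
    \<open>b $ j\<close> times the combination evaluated at node \<open>j + 1\<close>, as vectors
    are indexed from 0.\<close>
  have row: "(?M *\<^sub>v v) $ j = b $ j * comb (\<lambda>k. v $ (k - 1)) (x (Suc j)) - v $ j" if "j < m" for j
  proof -
    have "(?M *\<^sub>v v) $ j = (\<Sum>k<m. (w x (k + 1) (x (j + 1)) * b $ j - (if j = k then 1 else 0)) * v $ k)"
      using that assms by (simp add: scalar_prod_def lessThan_atLeast0)
    also have "\<dots> = (\<Sum>k<m. b $ j * (v $ k * w x (Suc k) (x (Suc j))) - (if j = k then v $ k else 0))"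
      by (intro sum.cong) (auto simp: algebra_simps)
    also have "\<dots> = b $ j * (\<Sum>k<m. v $ k * w x (Suc k) (x (Suc j))) - v $ j"
      using that by (simp add: sum_subtractf sum_distrib_left)
    also have "(\<Sum>k<m. v $ k * w x (Suc k) (x (Suc j))) = comb (\<lambda>k. v $ (k - 1)) (x (Suc j))"
      by (simp add: comb_def sum.atLeast1_atMost_eq)
    finally show ?thesis .
  qed
  have "?M *\<^sub>v v = 0\<^sub>v m \<longleftrightarrow> (\<forall>j<m. (?M *\<^sub>v v) $ j = 0)"
    by (auto simp: vec_eq_iff simp del: index_mult_mat_vec)
  also have "\<dots> \<longleftrightarrow> (\<forall>j<m. v $ j = b $ j * comb (\<lambda>k. v $ (k - 1)) (x (Suc j)))"
  proof (intro all_cong)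
    fix j assume "j < m"
    from row[OF this]
    show "(?M *\<^sub>v v) $ j = 0 \<longleftrightarrow> v $ j = b $ j * comb (\<lambda>k. v $ (k - 1)) (x (Suc j))"
      by linarith
  qed
  also have "\<dots> \<longleftrightarrow> (\<forall>j\<in>{1..m}. v $ (j - 1) = b $ (j - 1) * comb (\<lambda>k. v $ (k - 1)) (x j))"
    unfolding image_Suc_lessThan[symmetric] by (simp del: image_Suc_lessThan) auto
  finally show ?thesis .
qed

text \<open>A solution \<open>u\<close> yields the weights \<open>b $ (j - 1) * u (x j)\<close>, and
  weights yield their combination of Green's functions. Nontriviality passes both ways: zero weights
  give the zero function, and a nonzero weight forces a nonzero value at its node.\<close>

lemma nontrivial_solution_iff:
  "(\<exists>u. is_solution m x b u \<and> (\<exists>t\<in>{0..1}. u t \<noteq> 0)) \<longleftrightarrow>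
    (\<exists>v\<in>carrier_vec m. v \<noteq> 0\<^sub>v m \<and>
      (\<forall>j\<in>{1..m}. v $ (j - 1) = b $ (j - 1) * comb (\<lambda>k. v $ (k - 1)) (x j)))"
proof
  assume "\<exists>u. is_solution m x b u \<and> (\<exists>t\<in>{0..1}. u t \<noteq> 0)"
  then obtain u t where u: "is_solution m x b u" and t: "t \<in> {0..1}" "u t \<noteq> 0" by blast
  define v where "v = vec m (\<lambda>j. b $ j * u (x (j + 1)))"
  have v: "v $ (j - 1) = b $ (j - 1) * u (x j)" if "j \<in> {1..m}" for j
    using that by (auto simp: v_def)
  have u_eq: "u s = comb (\<lambda>k. v $ (k - 1)) s" if "s \<in> {0..1}" for s
    unfolding solution_eq_comb[OF u that] comb_def using v by (intro sum.cong) auto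
  have "v \<in> carrier_vec m" by (simp add: v_def)
  moreover have "v \<noteq> 0\<^sub>v m"
  proof
    assume "v = 0\<^sub>v m"
    then have "comb (\<lambda>k. v $ (k - 1)) t = 0"
      by (auto simp: comb_def intro!: sum.neutral)
    then show False using u_eq t by simp
  qed
  moreover have "v $ (j - 1) = b $ (j - 1) * comb (\<lambda>k. v $ (k - 1)) (x j)" if "j \<in> {1..m}" for j
    using v[OF that] u_eq[of "x j"] x_in[OF that] by simp
  ultimately show "\<exists>v\<in>carrier_vec m. v \<noteq> 0\<^sub>v m \<and>
      (\<forall>j\<in>{1..m}. v $ (j - 1) = b $ (j - 1) * comb (\<lambda>k. v $ (k - 1)) (x j))"
    by blast
next
  assume "\<exists>v\<in>carrier_vec m. v \<noteq> 0\<^sub>v m \<and>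
      (\<forall>j\<in>{1..m}. v $ (j - 1) = b $ (j - 1) * comb (\<lambda>k. v $ (k - 1)) (x j))"
  then obtain v where v: "v \<in> carrier_vec m" "v \<noteq> 0\<^sub>v m"
    and eq: "\<And>j. j \<in> {1..m} \<Longrightarrow> v $ (j - 1) = b $ (j - 1) * comb (\<lambda>k. v $ (k - 1)) (x j)"
    by blast
  obtain i where i: "i < m" "v $ i \<noteq> 0"
    using v by (metis carrier_vecD eq_vecI index_zero_vec)
  \<comment> \<open>The nonzero entry \<open>v $ i\<close> is the product of \<open>b $ i\<close>
    and this value, so the value cannot vanish.\<close>
  then have "comb (\<lambda>k. v $ (k - 1)) (x (Suc i)) \<noteq> 0" "x (Suc i) \<in> {0..1}"
    using eq[of "Suc i"] x_in[of "Suc i"] by auto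
  then show "\<exists>u. is_solution m x b u \<and> (\<exists>t\<in>{0..1}. u t \<noteq> 0)"
    using comb_is_solution[of "\<lambda>k. v $ (k - 1)" b, OF eq] by blast
qed

end

theorem mainTheorem4:
  fixes m :: nat and x :: "nat \<Rightarrow> real"
  assumes "m \<ge> 1"
    and "x 0 = 0" and "x (m + 1) = 1"
    and "\<And>i. i \<le> m \<Longrightarrow> x i < x (i + 1)"
  shows "resonance_set m x =
    {b \<in> carrier_vec m.
       det (mat m m (\<lambda>(j, k). w x (k + 1) (x (j + 1)) * b $ j - (if j = k then 1 else 0))) = 0}"
proof -
  interpret nodes m x by unfold_locales (use assms in auto)
  have "(\<exists>u. is_solution m x b u \<and> (\<exists>t\<in>{0..1}. u t \<noteq> 0)) \<longleftrightarrow>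
      det (mat m m (\<lambda>(j, k). w x (k + 1) (x (j + 1)) * b $ j - (if j = k then 1 else 0))) = 0"
    for b
    \<comment> \<open>The determinant vanishes exactly when some nonzero vector is annihilated,
      which \<open>kernel_iff\<close> turns into the weight equations.\<close>
    unfolding nontrivial_solution_iff
    by (subst det_0_iff_vec_prod_zero[OF mat_carrier]) (use kernel_iff in blast)
  then show ?thesis by (simp add: resonance_set_def)
qed

end
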